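(* Let $A_1,\dots,A_n$ be bounded linear operators on a complex Hilbert space $H$, let $\omega\in\mathbb{R}$ and $m\in\{1,\dots,n\}$ with $\sin(\omega m)\neq 0$. Then $$\left|\sum_{k=1}^n\exp(2\omega imk)A_k-\frac{\sin(\omega mn)}{\sin(\omega m)}\exp[\omega(n+1)im]\cdot\frac1n\sum_{k=1}^nA_k\right|^2 \le\left[n^2-\frac{\sin^2(\omega mn)}{\sin^2(\omega m)}\right]\left[\frac1n\sum_{k=1}^n|A_k|^2-\frac1{n^2}\left|\sum_{k=1}^nA_k\right|^2\right].$$
   Context: Here $i$ is the imaginary unit, $|T|=(T^*T)^{1/2}$ for a bounded operator $T$, and $\le$ is the usual order on self-adjoint bounded operators. The operator $\sum_{k=1}^n\exp(2\omega imk)A_k$ is the discrete Fourier transform at $m$ of $(A_1,\dots,A_n)$. *)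

theory Defs
  imports "HOL-Analysis.Analysis"
begin

class scaleC =
  fixes scaleC :: "complex \<Rightarrow> 'a \<Rightarrow> 'a"  (infixr \<open>*\<^sub>C\<close> 75)

text \<open>
  The real inner product, norm and topology inherited from \<^class>\<open>real_inner\<close> are those induced
  by \<open>cinner\<close>: the real inner product is the real part of \<open>cinner\<close>, so
  \<open>norm x = sqrt (Re (cinner x x))\<close>, and positive definiteness of \<open>cinner\<close> is inherited.
  \<open>cinner\<close> is linear in the first and conjugate-linear in the second argument.
\<close>

class complex_inner = real_inner + scaleC +
  fixes cinner :: "'a \<Rightarrow> 'a \<Rightarrow> complex"
  assumes scaleC_add_right: "a *\<^sub>C (x + y) = a *\<^sub>C x + a *\<^sub>C y"
    and scaleC_add_left: "(a + b) *\<^sub>C x = a *\<^sub>C x + b *\<^sub>C x"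
    and scaleC_scaleC: "a *\<^sub>C b *\<^sub>C x = (a * b) *\<^sub>C x"
    and scaleC_one: "1 *\<^sub>C x = x"
    and scaleR_scaleC: "r *\<^sub>R x = complex_of_real r *\<^sub>C x"
    and cinner_commute: "cinner x y = cnj (cinner y x)"
    and cinner_add_left: "cinner (x + y) z = cinner x z + cinner y z"
    and cinner_scaleC_left: "cinner (c *\<^sub>C x) y = c * cinner x y"
    and inner_eq_Re_cinner: "inner x y = Re (cinner x y)"

class chilbert_space = complex_inner + complete_space

instantiation complex :: chilbert_space
begin

definition scaleC_complex :: "complex \<Rightarrow> complex \<Rightarrow> complex"
  where "scaleC_complex c x = c * x"

definition cinner_complex :: "complex \<Rightarrow> complex \<Rightarrow> complex"
  where "cinner_complex x y = x * cnj y"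

instance
  by standard
    (auto simp: scaleC_complex_def cinner_complex_def algebra_simps scaleR_conv_of_real
      inner_complex_def)

end

lemma norm_scaleC:
  fixes x :: "'a::complex_inner"
  shows "norm (c *\<^sub>C x) = cmod c * norm x"
proof -
  have "cinner (c *\<^sub>C x) (c *\<^sub>C x) = c * cnj (c * cinner x x)"
    by (metis cinner_commute cinner_scaleC_left)
  also have "\<dots> = complex_of_real ((cmod c)\<^sup>2) * cinner x x"
    by (metis cinner_commute complex_cnj_mult complex_norm_square mult.assoc)
  finally have "inner (c *\<^sub>C x) (c *\<^sub>C x) = (cmod c)\<^sup>2 * inner x x"
    by (simp add: inner_eq_Re_cinner)
  then show ?thesis
    by (simp add: norm_eq_sqrt_inner real_sqrt_mult)
qed

lemma bounded_linear_scaleC_right: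
  "bounded_linear (\<lambda>x::'a::complex_inner. c *\<^sub>C x)"
proof (rule bounded_linear_intro[where K = "cmod c"])
  show "c *\<^sub>C (r *\<^sub>R x) = r *\<^sub>R (c *\<^sub>C x)" for r and x :: 'a
    by (simp add: scaleR_scaleC scaleC_scaleC mult.commute)
qed (simp_all add: scaleC_add_right norm_scaleC mult.commute)

instantiation blinfun :: (real_normed_vector, complex_inner) scaleC
begin

lift_definition scaleC_blinfun :: "complex \<Rightarrow> 'a \<Rightarrow>\<^sub>L 'b \<Rightarrow> 'a \<Rightarrow>\<^sub>L 'b"
  is "\<lambda>c f x. c *\<^sub>C f x"
  by (rule bounded_linear_compose[OF bounded_linear_scaleC_right])

instance ..

end

text \<open>
  \<^typ>\<open>'a \<Rightarrow>\<^sub>L 'a\<close> consists of the bounded real-linear maps; the bounded operators of a complex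
  Hilbert space are those that satisfy \<open>clinear_op\<close>.
\<close>

definition clinear_op :: "('a::complex_inner \<Rightarrow>\<^sub>L 'a) \<Rightarrow> bool"
  where "clinear_op T \<longleftrightarrow> (\<forall>c x. T (c *\<^sub>C x) = c *\<^sub>C T x)"

definition adj :: "('a::chilbert_space \<Rightarrow>\<^sub>L 'a) \<Rightarrow> ('a \<Rightarrow>\<^sub>L 'a)"
  where "adj T = (THE S. clinear_op S \<and> (\<forall>x y. cinner (T x) y = cinner x (S y)))"

definition selfadjoint_op :: "('a::chilbert_space \<Rightarrow>\<^sub>L 'a) \<Rightarrow> bool"
  where "selfadjoint_op T \<longleftrightarrow> clinear_op T \<and> adj T = T"

text \<open>For self-adjoint \<open>T\<close> the number \<open>cinner (T x) x\<close> is real.\<close>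

definition positive_op :: "('a::chilbert_space \<Rightarrow>\<^sub>L 'a) \<Rightarrow> bool"
  where "positive_op T \<longleftrightarrow> selfadjoint_op T \<and> (\<forall>x. 0 \<le> Re (cinner (T x) x))"

definition op_le :: "('a::chilbert_space \<Rightarrow>\<^sub>L 'a) \<Rightarrow> ('a \<Rightarrow>\<^sub>L 'a) \<Rightarrow> bool"  (infix \<open>\<preceq>\<close> 50)
  where "S \<preceq> T \<longleftrightarrow> selfadjoint_op S \<and> selfadjoint_op T \<and> positive_op (T - S)"

abbreviation op_square :: "('a::real_normed_vector \<Rightarrow>\<^sub>L 'a) \<Rightarrow> ('a \<Rightarrow>\<^sub>L 'a)"
  where "op_square T \<equiv> T o\<^sub>L T"

text \<open>A positive operator has exactly one positive square root.\<close>

definition op_sqrt :: "('a::chilbert_space \<Rightarrow>\<^sub>L 'a) \<Rightarrow> ('a \<Rightarrow>\<^sub>L 'a)"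
  where "op_sqrt T = (THE P. positive_op P \<and> op_square P = T)"

definition op_abs :: "('a::chilbert_space \<Rightarrow>\<^sub>L 'a) \<Rightarrow> ('a \<Rightarrow>\<^sub>L 'a)"
  where "op_abs T = op_sqrt (adj T o\<^sub>L T)"

end

theory Submission
  imports Defs
begin

text \<open>
  Write \<open>z\<^sub>k = exp (2\<omega>imk)\<close>. A geometric sum gives
  \<open>z\<^sub>1 + \<dots> + z\<^sub>n = (sin (\<omega>mn) / sin (\<omega>m)) exp (\<omega>(n+1)im)\<close>, so that the scalar factor on the left
  of the claimed inequality is the sum of the weights. Subtracting the product of this sum with
  the mean of the operators amounts to centring both families:
  \<open>\<Sum>\<^sub>k z\<^sub>k a\<^sub>k - (\<Sum>\<^sub>k z\<^sub>k) a' = \<Sum>\<^sub>k (z\<^sub>k - z')(a\<^sub>k - a')\<close> with \<open>a'\<close> and \<open>z'\<close> the means.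
  At each vector \<open>x\<close>, with \<open>a\<^sub>k = A\<^sub>k x\<close>, the Cauchy-Schwarz inequality bounds the square of the norm by the
  product of the two variances, which are the two brackets on the right (the factors \<open>n\<close> and
  \<open>1/n\<close> cancel). This is \<open>norm_weighted_sum_diff_means_le\<close>, combined with \<open>sin_mult_sum_exp\<close>.

  To pass from vectors to operators one needs \<open>|T|\<^sup>2 = T\<^sup>*T\<close>, hence
  \<open>\<langle>|T|\<^sup>2 x, x\<rangle> = \<parallel>T x\<parallel>\<^sup>2\<close>. As adjoint and square root are definite descriptions, both
  have to be shown to exist and to be unique. Adjoints come from the Riesz representation theorem.
  For the square root, scale \<open>T\<close> so that \<open>B = 1 - T\<^sup>*T\<close> has norm at most one. The root is then
  \<open>1 - Y\<close> with \<open>Y = (B + Y\<^sup>2) / 2\<close>, and \<open>Y\<close> is the limit of the fixed-point iteration starting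
  at \<open>0\<close>. The same iteration for the number \<open>1\<close> in place of \<open>B\<close> dominates it in norm, which yields
  convergence. The limit commutes with everything that commutes with \<open>T\<^sup>*T\<close>, in particular with
  any other positive square root, and two commuting positive roots agree.
\<close>

section \<open>Complex-linear operators and complex inner products\<close>

text \<open>
  The first-order condition at a minimum, for a quadratic in \<open>t\<close>: \<open>t = - b / (\<bar>c\<bar> + 1)\<close> makes it
  negative unless \<open>b = 0\<close>. It yields both the Riesz representation and the fact that
  \<open>P y = 0\<close> if the form of a positive \<open>P\<close> vanishes at \<open>y\<close>.
\<close>

lemma quadratic_nonneg_imp_linear_coeff_zero:
  fixes b c :: real
  assumes "\<And>t. 0 \<le> 2 * t * b + t\<^sup>2 * c"
  shows "b = 0"
proof (rule ccontr)
  assume "b \<noteq> 0"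
  define d where "d = \<bar>c\<bar> + 1"
  have "d > 0" by (simp add: d_def)
  have "c < 2 * d" using \<open>d > 0\<close> by (simp add: d_def abs_if)
  have "2 * (- b / d) * b + (- b / d)\<^sup>2 * c = b\<^sup>2 / d\<^sup>2 * (c - 2 * d)"
    using \<open>d > 0\<close> by (simp add: field_simps power2_eq_square)
  also have "\<dots> < 0"
    using \<open>b \<noteq> 0\<close> \<open>d > 0\<close> \<open>c < 2 * d\<close> by (intro mult_pos_neg) auto
  finally show False using assms[of "- b / d"] by simp
qed

lemma scaleC_zero_left [simp]: "0 *\<^sub>C (x::'a::complex_inner) = 0"
  by (metis scaleR_scaleC of_real_0 scaleR_zero_left)

lemma scaleC_zero_right [simp]: "c *\<^sub>C (0::'a::complex_inner) = 0"
  using linear_0[OF bounded_linear.linear[OF bounded_linear_scaleC_right]] .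

lemma scaleC_diff_right: "c *\<^sub>C (x - y :: 'a::complex_inner) = c *\<^sub>C x - c *\<^sub>C y"
  using linear_diff[OF bounded_linear.linear[OF bounded_linear_scaleC_right]] .

lemma scaleC_diff_left: "(a - b) *\<^sub>C (x::'a::complex_inner) = a *\<^sub>C x - b *\<^sub>C x"
  by (metis add_diff_cancel_right' diff_add_cancel scaleC_add_left)

lemma scaleC_sum_right: "c *\<^sub>C (\<Sum>k\<in>I. f k :: 'a::complex_inner) = (\<Sum>k\<in>I. c *\<^sub>C f k)"
  using linear_sum[OF bounded_linear.linear[OF bounded_linear_scaleC_right]] .

lemma scaleC_sum_left: "(\<Sum>k\<in>I. f k) *\<^sub>C (x::'a::complex_inner) = (\<Sum>k\<in>I. f k *\<^sub>C x)"
  by (induction I rule: infinite_finite_induct) (auto simp: scaleC_add_left)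

lemma scaleC_scaleR: "c *\<^sub>C r *\<^sub>R (x::'a::complex_inner) = r *\<^sub>R c *\<^sub>C x"
  by (simp add: scaleR_scaleC scaleC_scaleC mult.commute)

lemma cinner_scaleC_right: "cinner x (c *\<^sub>C y) = cnj c * cinner x (y::'a::complex_inner)"
  by (metis cinner_commute cinner_scaleC_left complex_cnj_mult)

text \<open>
  The complex inner product is determined by its real part, so for complex-linear operators
  adjoints and positivity can be characterised through the real inner product.
\<close>

lemma cinner_eq_Complex_inner:
  "cinner x (y::'a::complex_inner) = Complex (inner x y) (inner x (\<i> *\<^sub>C y))"
  by (simp add: complex_eq_iff inner_eq_Re_cinner cinner_scaleC_right)

lemma inner_scaleC_cnj: "inner (c *\<^sub>C x) y = inner x (cnj c *\<^sub>C (y::'a::complex_inner))"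
  by (simp add: inner_eq_Re_cinner cinner_scaleC_left cinner_scaleC_right)

lemma clinear_opD: "clinear_op T \<Longrightarrow> T (c *\<^sub>C x) = c *\<^sub>C T x"
  by (simp add: clinear_op_def)

lemma scaleC_blinfun_apply [simp]: "blinfun_apply (c *\<^sub>C T) x = c *\<^sub>C T x"
  by transfer simp

lemma clinear_op_id: "clinear_op id_blinfun"
  and clinear_op_zero: "clinear_op 0"
  and clinear_op_compose: "clinear_op S \<Longrightarrow> clinear_op T \<Longrightarrow> clinear_op (S o\<^sub>L T)"
  and clinear_op_add: "clinear_op S \<Longrightarrow> clinear_op T \<Longrightarrow> clinear_op (S + T)"
  and clinear_op_diff: "clinear_op S \<Longrightarrow> clinear_op T \<Longrightarrow> clinear_op (S - T)"
  and clinear_op_scaleR: "clinear_op T \<Longrightarrow> clinear_op (r *\<^sub>R T)"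
  and clinear_op_scaleC: "clinear_op T \<Longrightarrow> clinear_op (c *\<^sub>C T)"
  by (auto simp: clinear_op_def blinfun.bilinear_simps scaleC_add_right scaleC_diff_right
      scaleC_scaleR scaleC_scaleC mult.commute)

lemma clinear_op_sum: "(\<And>k. k \<in> I \<Longrightarrow> clinear_op (T k)) \<Longrightarrow> clinear_op (\<Sum>k\<in>I. T k)"
  by (induction I rule: infinite_finite_induct) (auto intro: clinear_op_zero clinear_op_add)

lemma clinear_op_limit:
  assumes "X \<longlonglongrightarrow> Y" "\<And>k. clinear_op (X k)"
  shows "clinear_op Y"
  unfolding clinear_op_def
proof (intro allI)
  fix c x
  have "(\<lambda>k. X k (c *\<^sub>C x)) \<longlonglongrightarrow> Y (c *\<^sub>C x)"
    by (intro tendsto_intros assms)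
  moreover have "(\<lambda>k. c *\<^sub>C X k x) \<longlonglongrightarrow> c *\<^sub>C Y x"
    by (intro bounded_linear.tendsto[OF bounded_linear_scaleC_right] tendsto_intros assms)
  ultimately show "Y (c *\<^sub>C x) = c *\<^sub>C Y x"
    using assms(2) by (auto simp: clinear_op_def intro: LIMSEQ_unique)
qed

section \<open>Riesz representation and adjoints\<close>

text \<open>
  The representing vector \<open>y\<^sub>0\<close> minimises \<open>J y = \<parallel>y\<parallel>\<^sup>2 - 2 f y = \<parallel>y - y\<^sub>0\<parallel>\<^sup>2 - \<parallel>y\<^sub>0\<parallel>\<^sup>2\<close>. The
  parallelogram identity makes minimising sequences Cauchy, and the vanishing first variation of
  \<open>J\<close> at the minimiser is the representation.
\<close>

lemma riesz_representation:
  fixes f :: "'a::{real_inner, complete_space} \<Rightarrow> real"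
  assumes "bounded_linear f"
  obtains y where "\<And>x. f x = inner x y"
proof -
  interpret f: bounded_linear f by fact
  define J where "J y = (norm y)\<^sup>2 - 2 * f y" for y
  obtain K where K: "\<And>x. norm (f x) \<le> norm x * K"
    using f.bounded by blast
  have lower: "- K\<^sup>2 \<le> J y" for y
  proof -
    have "f y \<le> norm y * K" using K[of y] by simp
    moreover have "0 \<le> (norm y - K)\<^sup>2" by simp
    ultimately show ?thesis by (simp add: J_def power2_diff)
  qed
  define d where "d = (INF y. J y)"
  have bdd: "bdd_below (range J)" using lower by (rule bdd_belowI2)
  have d_le: "d \<le> J y" for y
    unfolding d_def using bdd by (auto intro: cINF_lower)
  have "\<exists>y. J y < d + 1 / real (Suc k)" for k
  proof -
    have "\<exists>z\<in>range J. z < d + 1 / real (Suc k)"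
      by (rule cInf_lessD) (auto simp: d_def)
    then show ?thesis by auto
  qed
  then obtain u where u: "\<And>k. J (u k) < d + 1 / real (Suc k)" by metis
  have parallelogram: "(norm (v - w))\<^sup>2 = 2 * J v + 2 * J w - 4 * J ((1/2) *\<^sub>R (v + w))" for v w
    by (simp add: J_def power2_norm_eq_inner f.add f.scaleR inner_add inner_diff inner_commute
        algebra_simps)
  have "Cauchy u"
  proof (rule metric_CauchyI)
    fix e :: real assume "e > 0"
    then obtain N where N: "1 / real (Suc N) < e\<^sup>2 / 4"
      using nat_approx_posE[of "e\<^sup>2 / 4"] by auto
    have "dist (u i) (u j) < e" if "i \<ge> N" "j \<ge> N" for i j
    proof -
      have "1 / real (Suc i) \<le> 1 / real (Suc N)" "1 / real (Suc j) \<le> 1 / real (Suc N)"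
        using that by (auto simp: frac_le)
      then have "(norm (u i - u j))\<^sup>2 < e\<^sup>2"
        using parallelogram[of "u i" "u j"] u[of i] u[of j] d_le[of "(1/2) *\<^sub>R (u i + u j)"] N
        by linarith
      then show ?thesis
        using \<open>e > 0\<close> by (simp add: dist_norm power2_less_imp_less)
    qed
    then show "\<exists>N. \<forall>i\<ge>N. \<forall>j\<ge>N. dist (u i) (u j) < e" by blast
  qed
  then obtain y where y: "u \<longlonglongrightarrow> y" using Cauchy_convergent convergentD by blast
  have "(\<lambda>k. J (u k)) \<longlonglongrightarrow> J y"
    unfolding J_def by (intro tendsto_intros f.tendsto y)
  moreover have "(\<lambda>k. d + 1 / real (Suc k)) \<longlonglongrightarrow> d + 0"
    by (intro tendsto_intros LIMSEQ_Suc[OF lim_1_over_n])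
  ultimately have "J y \<le> d"
    using LIMSEQ_le[of "\<lambda>k. J (u k)" "J y" _ "d + 0"] u by (auto intro: less_imp_le)
  have "f x = inner x y" for x
  proof -
    have "0 \<le> 2 * t * (inner x y - f x) + t\<^sup>2 * (norm x)\<^sup>2" for t
    proof -
      have "J (y + t *\<^sub>R x) - J y = 2 * t * (inner x y - f x) + t\<^sup>2 * (norm x)\<^sup>2"
        by (simp add: J_def power2_norm_eq_inner f.add f.scaleR inner_add inner_commute
            algebra_simps power2_eq_square[of t])
      then show ?thesis using \<open>J y \<le> d\<close> d_le[of "y + t *\<^sub>R x"] by simp
    qed
    from quadratic_nonneg_imp_linear_coeff_zero[OF this] show ?thesis by simp
  qed
  then show thesis by (rule that)
qed

lemma cinner_adjoint_iff:
  assumes "clinear_op T" "clinear_op S"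
  shows "(\<forall>x y. cinner (T x) y = cinner x (S y)) \<longleftrightarrow> (\<forall>x y. inner (T x) y = inner x (S y))"
  using assms by (auto simp: cinner_eq_Complex_inner clinear_op_def)

lemma adj_eqI:
  fixes T S :: "'a::chilbert_space \<Rightarrow>\<^sub>L 'a"
  assumes "clinear_op T" "clinear_op S" and S: "\<And>x y. inner (T x) y = inner x (S y)"
  shows "adj T = S"
  unfolding adj_def
proof (rule the_equality)
  show "clinear_op S \<and> (\<forall>x y. cinner (T x) y = cinner x (S y))"
    using assms cinner_adjoint_iff by blast
next
  fix R assume R: "clinear_op R \<and> (\<forall>x y. cinner (T x) y = cinner x (R y))"
  then have "inner x (R y) = inner x (S y)" for x y
    using S by (metis inner_eq_Re_cinner)
  then have "inner x (R y - S y) = 0" for x y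
    by (simp add: inner_diff_right)
  then show "R = S"
    by (intro blinfun_eqI) (metis eq_iff_diff_eq_0 inner_eq_zero_iff)
qed

lemma adj_exists:
  fixes T :: "'a::chilbert_space \<Rightarrow>\<^sub>L 'a"
  assumes T: "clinear_op T"
  shows "\<exists>S. clinear_op S \<and> (\<forall>x y. inner (T x) y = inner x (S y))"
proof -
  have "\<exists>z. \<forall>x. inner (T x) y = inner x z" for y
  proof -
    have "bounded_linear (\<lambda>x. inner (T x) y)"
      by (intro bounded_linear_compose[OF bounded_linear_inner_left] blinfun.bounded_linear_right)
    then show ?thesis by (metis riesz_representation)
  qed
  then obtain g where g: "\<And>x y. inner (T x) y = inner x (g y)" by metis
  have eqI: "a = b" if "\<And>x. inner x a = inner x b" for a b :: 'a
    using that[of "a - b"] by (metis eq_iff_diff_eq_0 inner_diff_right inner_eq_zero_iff)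
  have "bounded_linear g"
  proof (rule bounded_linear_intro)
    show "g (x + y) = g x + g y" for x y
      by (rule eqI) (simp add: inner_add_right flip: g)
    show "g (r *\<^sub>R x) = r *\<^sub>R g x" for r x
      by (rule eqI) (simp flip: g)
    show "norm (g y) \<le> norm y * norm T" for y
    proof (cases "g y = 0")
      case False
      have "(norm (g y))\<^sup>2 = inner (T (g y)) y"
        by (simp add: g power2_norm_eq_inner)
      also have "\<dots> \<le> norm (T (g y)) * norm y" by (rule norm_cauchy_schwarz)
      also have "\<dots> \<le> (norm T * norm (g y)) * norm y"
        by (intro mult_right_mono norm_blinfun) auto
      finally show ?thesis using False by (simp add: power2_eq_square algebra_simps)
    qed simp
  qed
  then have app: "blinfun_apply (Blinfun g) = g" by (rule bounded_linear_Blinfun_apply)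
  have "g (c *\<^sub>C y) = c *\<^sub>C g y" for c y
  proof (rule eqI)
    fix x
    have "inner x (c *\<^sub>C g y) = inner (cnj c *\<^sub>C x) (g y)"
      by (simp add: inner_scaleC_cnj)
    also have "\<dots> = inner (cnj c *\<^sub>C T x) y"
      using T by (simp add: clinear_opD flip: g)
    also have "\<dots> = inner x (g (c *\<^sub>C y))"
      by (simp add: inner_scaleC_cnj g)
    finally show "inner x (g (c *\<^sub>C y)) = inner x (c *\<^sub>C g y)" ..
  qed
  then have "clinear_op (Blinfun g) \<and> (\<forall>x y. inner (T x) y = inner x (Blinfun g y))"
    by (simp add: clinear_op_def app g)
  then show ?thesis ..
qed

lemma
  fixes T :: "'a::chilbert_space \<Rightarrow>\<^sub>L 'a"
  assumes "clinear_op T"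
  shows clinear_op_adj: "clinear_op (adj T)"
    and inner_adj: "inner (T x) y = inner x (adj T y)"
  using adj_exists[OF assms] adj_eqI[OF assms] by auto

lemma selfadjoint_op_iff:
  "selfadjoint_op T \<longleftrightarrow> clinear_op T \<and> (\<forall>x y. inner (T x) y = inner x (T y))"
  unfolding selfadjoint_op_def using adj_eqI inner_adj by metis

lemma selfadjoint_op_adj_compose:
  assumes "clinear_op T"
  shows "selfadjoint_op (adj T o\<^sub>L T)"
  using inner_adj[OF assms] clinear_op_adj[OF assms] assms
  by (auto simp: selfadjoint_op_iff clinear_op_compose) (metis inner_commute)

lemma inner_adj_compose:
  assumes "clinear_op T"
  shows "inner ((adj T o\<^sub>L T) x) x = (norm (T x))\<^sup>2"
  using inner_adj[OF assms, of x "T x"] by (simp add: power2_norm_eq_inner inner_commute)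

lemma selfadjoint_op_id: "selfadjoint_op id_blinfun"
  and selfadjoint_op_zero: "selfadjoint_op 0"
  and selfadjoint_op_add: "selfadjoint_op S \<Longrightarrow> selfadjoint_op T \<Longrightarrow> selfadjoint_op (S + T)"
  and selfadjoint_op_diff: "selfadjoint_op S \<Longrightarrow> selfadjoint_op T \<Longrightarrow> selfadjoint_op (S - T)"
  and selfadjoint_op_scaleR: "selfadjoint_op T \<Longrightarrow> selfadjoint_op (r *\<^sub>R T)"
  and selfadjoint_op_square: "selfadjoint_op T \<Longrightarrow> selfadjoint_op (T o\<^sub>L T)"
  by (auto simp: selfadjoint_op_iff clinear_op_id clinear_op_zero clinear_op_add clinear_op_diff
      clinear_op_scaleR clinear_op_compose blinfun.bilinear_simps inner_add inner_diff)

lemma selfadjoint_op_sum: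
  "(\<And>k. k \<in> I \<Longrightarrow> selfadjoint_op (T k)) \<Longrightarrow> selfadjoint_op (\<Sum>k\<in>I. T k)"
  by (induction I rule: infinite_finite_induct)
    (auto intro: selfadjoint_op_zero selfadjoint_op_add)

lemma selfadjoint_op_limit:
  assumes "X \<longlonglongrightarrow> Y" "\<And>k. selfadjoint_op (X k)"
  shows "selfadjoint_op Y"
proof -
  have "inner (Y x) y = inner x (Y y)" for x y
  proof (rule LIMSEQ_unique)
    show "(\<lambda>k. inner (X k x) y) \<longlonglongrightarrow> inner (Y x) y"
      by (intro tendsto_intros assms)
    have "(\<lambda>k. inner x (X k y)) \<longlonglongrightarrow> inner x (Y y)"
      by (intro tendsto_intros assms)
    then show "(\<lambda>k. inner (X k x) y) \<longlonglongrightarrow> inner x (Y y)"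
      using assms(2) by (simp add: selfadjoint_op_iff)
  qed
  then show ?thesis
    using clinear_op_limit[OF assms(1)] assms(2) by (simp add: selfadjoint_op_iff)
qed

lemma positive_op_iff: "positive_op T \<longleftrightarrow> selfadjoint_op T \<and> (\<forall>x. 0 \<le> inner (T x) x)"
  by (simp add: positive_op_def inner_eq_Re_cinner)

text \<open>
  The form of \<open>P\<close> is minimal at \<open>y\<close>, so its derivative at \<open>y\<close> in the direction \<open>P y\<close> vanishes;
  this derivative is \<open>2 \<parallel>P y\<parallel>\<^sup>2\<close>.
\<close>

lemma positive_op_inner_zero:
  assumes "positive_op P" "inner (P y) y = 0"
  shows "P y = 0"
proof -
  have sym: "inner (P u) v = inner u (P v)" and pos: "0 \<le> inner (P u) u" for u v
    using assms(1) by (auto simp: positive_op_iff selfadjoint_op_iff)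
  have "0 \<le> 2 * t * (norm (P y))\<^sup>2 + t\<^sup>2 * inner (P (P y)) (P y)" for t
  proof -
    have "inner (P (y + t *\<^sub>R P y)) (y + t *\<^sub>R P y)
        = 2 * t * (norm (P y))\<^sup>2 + t\<^sup>2 * inner (P (P y)) (P y)"
      using assms(2) sym[of "P y" y]
      by (simp add: blinfun.bilinear_simps inner_add power2_norm_eq_inner
          algebra_simps power2_eq_square[of t])
    then show ?thesis using pos[of "y + t *\<^sub>R P y"] by simp
  qed
  from quadratic_nonneg_imp_linear_coeff_zero[OF this] show ?thesis by simp
qed

section \<open>The positive square root\<close>

text \<open>
  If \<open>Y = (B + Y\<^sup>2) / 2\<close> then \<open>(1 - Y)\<^sup>2 = 1 - B\<close>, so a root of \<open>1 - B\<close> arises from a fixed point.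
\<close>

fun sqrt_iter :: "('a::real_normed_vector \<Rightarrow>\<^sub>L 'a) \<Rightarrow> nat \<Rightarrow> 'a \<Rightarrow>\<^sub>L 'a" where
  "sqrt_iter B 0 = 0"
| "sqrt_iter B (Suc k) = (1/2) *\<^sub>R (B + op_square (sqrt_iter B k))"

text \<open>
  The iteration for the number \<open>1\<close> in place of \<open>B\<close>, which increases to the fixed point \<open>1\<close>.
\<close>

fun sqrt_majorant :: "nat \<Rightarrow> real" where
  "sqrt_majorant 0 = 0"
| "sqrt_majorant (Suc k) = (1 + (sqrt_majorant k)\<^sup>2) / 2"

lemma sqrt_majorant_bounds: "0 \<le> sqrt_majorant k" "sqrt_majorant k \<le> 1"
proof -
  have "0 \<le> sqrt_majorant k \<and> sqrt_majorant k \<le> 1"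
    by (induction k) (auto simp: power_le_one)
  then show "0 \<le> sqrt_majorant k" "sqrt_majorant k \<le> 1" by auto
qed

lemma incseq_sqrt_majorant: "incseq sqrt_majorant"
proof (rule incseq_SucI)
  fix k
  have "0 \<le> (1 - sqrt_majorant k)\<^sup>2" by simp
  then show "sqrt_majorant k \<le> sqrt_majorant (Suc k)" by (simp add: power2_diff)
qed

lemma norm_sqrt_iter_le:
  assumes "norm B \<le> 1"
  shows "norm (sqrt_iter B k) \<le> sqrt_majorant k"
proof (induction k)
  case (Suc k)
  have "norm (op_square (sqrt_iter B k)) \<le> norm (sqrt_iter B k) * norm (sqrt_iter B k)"
    by (rule norm_blinfun_compose)
  also have "\<dots> \<le> sqrt_majorant k * sqrt_majorant k"
    using Suc sqrt_majorant_bounds by (intro mult_mono) auto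
  finally have "norm (B + op_square (sqrt_iter B k)) \<le> 1 + (sqrt_majorant k)\<^sup>2"
    using assms norm_triangle_ineq[of B "op_square (sqrt_iter B k)"]
    by (simp add: power2_eq_square)
  then show ?case by simp
qed simp

lemma sqrt_iter_commute:
  assumes "C o\<^sub>L B = B o\<^sub>L C"
  shows "C o\<^sub>L sqrt_iter B k = sqrt_iter B k o\<^sub>L C"
proof (induction k)
  case 0
  show ?case by (intro blinfun_eqI) simp
next
  case (Suc k)
  have "C (B x) = B (C x)" "C (sqrt_iter B k x) = sqrt_iter B k (C x)" for x
    using assms Suc by (metis blinfun_apply_blinfun_compose)+
  then show ?case by (intro blinfun_eqI) (simp add: blinfun.bilinear_simps)
qed

text \<open>
  Successive iterates commute, so that \<open>Y\<^sup>2 - X\<^sup>2 = (Y + X)(Y - X)\<close>. Hence the increments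
  satisfy the same recursion as those of the majorant, with \<open>\<le>\<close> in place of \<open>=\<close>. Unlike a contraction
  argument this works up to and including norm one.
\<close>

lemma norm_sqrt_iter_diff_le:
  assumes "norm B \<le> 1"
  shows "norm (sqrt_iter B (Suc k) - sqrt_iter B k) \<le> sqrt_majorant (Suc k) - sqrt_majorant k"
proof (induction k)
  case 0
  show ?case using assms by simp
next
  case (Suc k)
  let ?Y = "sqrt_iter B (Suc k)" and ?X = "sqrt_iter B k"
  let ?y = "sqrt_majorant (Suc k)" and ?x = "sqrt_majorant k"
  have "?X o\<^sub>L B = B o\<^sub>L ?X"
    using sqrt_iter_commute[of B B k] by simp
  then have "?X o\<^sub>L ?Y = ?Y o\<^sub>L ?X" by (rule sqrt_iter_commute)
  then have comm: "?X (?Y u) = ?Y (?X u)" for u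
    by (metis blinfun_apply_blinfun_compose)
  have "sqrt_iter B (Suc (Suc k)) - ?Y
      = (1/2) *\<^sub>R (B + op_square ?Y) - (1/2) *\<^sub>R (B + op_square ?X)"
    by simp
  also have "\<dots> = (1/2) *\<^sub>R ((?Y + ?X) o\<^sub>L (?Y - ?X))"
    using comm by (intro blinfun_eqI)
      (simp del: sqrt_iter.simps add: blinfun.bilinear_simps algebra_simps)
  finally have "norm (sqrt_iter B (Suc (Suc k)) - ?Y)
      = norm ((?Y + ?X) o\<^sub>L (?Y - ?X)) / 2"
    by simp
  also have "\<dots> \<le> (norm (?Y + ?X) * norm (?Y - ?X)) / 2"
    by (intro divide_right_mono norm_blinfun_compose) simp
  also have "\<dots> \<le> ((?y + ?x) * (?y - ?x)) / 2"
  proof -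
    have "norm (?Y + ?X) \<le> ?y + ?x"
      by (intro norm_triangle_le add_mono norm_sqrt_iter_le[OF assms])
    moreover have "0 \<le> ?y + ?x" by (intro add_nonneg_nonneg sqrt_majorant_bounds)
    ultimately show ?thesis by (intro divide_right_mono mult_mono Suc.IH) auto
  qed
  also have "\<dots> = sqrt_majorant (Suc (Suc k)) - ?y"
    by (simp add: power2_eq_square field_simps)
  finally show ?case .
qed

text \<open>
  This makes the operators on a Hilbert space a Banach space, in which absolute convergence of
  the series of increments implies convergence.
\<close>

instance chilbert_space \<subseteq> banach ..

lemma convergent_sqrt_iter:
  fixes B :: "'a::chilbert_space \<Rightarrow>\<^sub>L 'a"
  assumes "norm B \<le> 1"
  shows "convergent (sqrt_iter B)"
proof -
  have "Bseq sqrt_majorant"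
    using sqrt_majorant_bounds by (intro BseqI'[where K = 1]) auto
  then have "convergent sqrt_majorant"
    using incseq_sqrt_majorant by (auto intro: Bseq_mono_convergent simp: incseq_def)
  then have "summable (\<lambda>k. sqrt_majorant (Suc k) - sqrt_majorant k)"
    using telescope_summable convergent_LIMSEQ_iff by blast
  then have "summable (\<lambda>k. sqrt_iter B (Suc k) - sqrt_iter B k)"
    by (rule summable_comparison_test'[where N = 0]) (rule norm_sqrt_iter_diff_le[OF assms])
  then have "convergent (\<lambda>n. \<Sum>k<n. sqrt_iter B (Suc k) - sqrt_iter B k)"
    by (simp add: summable_iff_convergent)
  then show ?thesis by (simp only: sum_lessThan_telescope sqrt_iter.simps(1) diff_zero)
qed

text \<open>
  The clause on commuting operators is what uniqueness of the root rests on.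
\<close>

lemma positive_sqrt_exists_of_norm_le:
  fixes B :: "'a::chilbert_space \<Rightarrow>\<^sub>L 'a"
  assumes B: "selfadjoint_op B" and norm: "norm B \<le> 1"
  shows "\<exists>P. positive_op P \<and> op_square P = id_blinfun - B
    \<and> (\<forall>C. C o\<^sub>L B = B o\<^sub>L C \<longrightarrow> C o\<^sub>L P = P o\<^sub>L C)"
proof -
  obtain Y where Y: "sqrt_iter B \<longlonglongrightarrow> Y"
    using convergent_sqrt_iter[OF norm] convergentD by blast
  have "selfadjoint_op (sqrt_iter B k)" for k
    by (induction k)
      (auto intro: selfadjoint_op_zero selfadjoint_op_scaleR selfadjoint_op_add
        selfadjoint_op_square B)
  then have self: "selfadjoint_op Y" by (rule selfadjoint_op_limit[OF Y])
  have normY: "norm Y \<le> 1"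
  proof (rule LIMSEQ_le_const2)
    show "(\<lambda>k. norm (sqrt_iter B k)) \<longlonglongrightarrow> norm Y" by (intro tendsto_norm Y)
    show "\<exists>N. \<forall>k\<ge>N. norm (sqrt_iter B k) \<le> 1"
      using norm_sqrt_iter_le[OF norm] sqrt_majorant_bounds(2) order_trans by blast
  qed
  have conv_comp: "(\<lambda>k. X k o\<^sub>L Z k) \<longlonglongrightarrow> (U o\<^sub>L V)" if "X \<longlonglongrightarrow> U" "Z \<longlonglongrightarrow> V"
    for X Z and U V :: "'a \<Rightarrow>\<^sub>L 'a"
    using bounded_bilinear.tendsto[OF bounded_bilinear_blinfun_compose that] .
  have fixed: "Y = (1/2) *\<^sub>R (B + op_square Y)"
  proof (rule LIMSEQ_unique)
    show "(\<lambda>k. sqrt_iter B (Suc k)) \<longlonglongrightarrow> Y" using Y by (rule LIMSEQ_Suc)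
    show "(\<lambda>k. sqrt_iter B (Suc k)) \<longlonglongrightarrow> (1/2) *\<^sub>R (B + op_square Y)"
      unfolding sqrt_iter.simps by (intro tendsto_intros conv_comp Y)
  qed
  define P where "P = id_blinfun - Y"
  have "inner (Y x) x \<le> inner x x" for x
  proof -
    have "inner (Y x) x \<le> norm (Y x) * norm x" by (rule norm_cauchy_schwarz)
    also have "\<dots> \<le> (norm Y * norm x) * norm x" by (intro mult_right_mono norm_blinfun) auto
    also have "\<dots> \<le> (1 * norm x) * norm x" by (intro mult_right_mono normY) auto
    finally show ?thesis by (simp add: power2_eq_square flip: power2_norm_eq_inner)
  qed
  then have "positive_op P"
    by (simp add: P_def positive_op_iff self selfadjoint_op_diff selfadjoint_op_id
        blinfun.bilinear_simps inner_diff_left)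
  moreover have "op_square P = id_blinfun - B"
  proof (rule blinfun_eqI)
    fix x
    have "Y x = (1/2) *\<^sub>R (B x + Y (Y x))"
      using arg_cong[OF fixed, of "\<lambda>T. blinfun_apply T x"] by (simp add: blinfun.bilinear_simps)
    then have "2 *\<^sub>R Y x = B x + Y (Y x)" by (metis scaleR_half_double scaleR_2 scaleR_right.add)
    then show "op_square P x = (id_blinfun - B) x"
      by (simp add: P_def blinfun.bilinear_simps scaleR_2 algebra_simps)
  qed
  moreover have "C o\<^sub>L P = P o\<^sub>L C" if "C o\<^sub>L B = B o\<^sub>L C" for C
  proof -
    have "C o\<^sub>L Y = Y o\<^sub>L C"
    proof (rule LIMSEQ_unique)
      show "(\<lambda>k. C o\<^sub>L sqrt_iter B k) \<longlonglongrightarrow> (C o\<^sub>L Y)" by (intro conv_comp Y tendsto_const)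
      show "(\<lambda>k. C o\<^sub>L sqrt_iter B k) \<longlonglongrightarrow> (Y o\<^sub>L C)"
        unfolding sqrt_iter_commute[OF that] by (intro conv_comp Y tendsto_const)
    qed
    then have "C (Y x) = Y (C x)" for x by (metis blinfun_apply_blinfun_compose)
    then show ?thesis by (intro blinfun_eqI) (simp add: P_def blinfun.bilinear_simps)
  qed
  ultimately show ?thesis by blast
qed

text \<open>
  With \<open>A = T\<^sup>*T\<close> and \<open>c \<ge> \<parallel>T\<^sup>*\<parallel>\<close> one has \<open>\<parallel>A x\<parallel>\<^sup>2 \<le> c\<^sup>2 \<parallel>T x\<parallel>\<^sup>2 = c\<^sup>2 \<langle>A x, x\<rangle>\<close>. This
  shows directly that \<open>1 - A / c\<^sup>2\<close> does not increase norms, without the formula that expresses the norm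
  of a self-adjoint operator through its quadratic form.
\<close>

lemma positive_sqrt_exists:
  fixes T :: "'a::chilbert_space \<Rightarrow>\<^sub>L 'a"
  assumes T: "clinear_op T"
  shows "\<exists>P. positive_op P \<and> op_square P = adj T o\<^sub>L T
    \<and> (\<forall>C. C o\<^sub>L (adj T o\<^sub>L T) = (adj T o\<^sub>L T) o\<^sub>L C \<longrightarrow> C o\<^sub>L P = P o\<^sub>L C)"
proof -
  define A where "A = adj T o\<^sub>L T"
  \<comment> \<open>The summand \<open>1\<close> keeps \<open>c\<close> positive if \<open>T = 0\<close>.\<close>
  define c where "c = norm (adj T) + 1"
  define B where "B = id_blinfun - (1 / c\<^sup>2) *\<^sub>R A"
  have "c > 0" by (simp add: c_def add_nonneg_pos)
  have self: "selfadjoint_op A" unfolding A_def by (rule selfadjoint_op_adj_compose[OF T])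
  have "norm (B x) \<le> 1 * norm x" for x
  proof -
    have "norm (A x) \<le> norm (adj T) * norm (T x)" by (simp add: A_def norm_blinfun)
    also have "\<dots> \<le> c * norm (T x)" by (intro mult_right_mono) (auto simp: c_def)
    finally have "(norm (A x))\<^sup>2 \<le> (c * norm (T x))\<^sup>2" by (rule power_mono) simp
    also have "\<dots> = c\<^sup>2 * inner (A x) x"
      by (simp add: A_def inner_adj_compose[OF T, simplified] power_mult_distrib)
    finally have *: "(norm (A x))\<^sup>2 / c\<^sup>2 \<le> inner (A x) x"
      using \<open>c > 0\<close> by (simp add: divide_le_eq mult.commute)
    have "0 \<le> inner (A x) x"
      by (simp add: A_def inner_adj_compose[OF T, simplified])
    define r where "r = 1 / c\<^sup>2"
    have "(norm (B x))\<^sup>2 = (norm x)\<^sup>2 - r * (2 * inner (A x) x - r * (norm (A x))\<^sup>2)"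
      by (simp add: B_def power2_norm_eq_inner blinfun.bilinear_simps inner_diff inner_commute
          algebra_simps flip: r_def)
    then have "(norm (B x))\<^sup>2
        = (norm x)\<^sup>2 - (2 * inner (A x) x - (norm (A x))\<^sup>2 / c\<^sup>2) / c\<^sup>2"
      by (simp add: r_def)
    also have "\<dots> \<le> (norm x)\<^sup>2"
      using * \<open>0 \<le> inner (A x) x\<close> \<open>c > 0\<close> by simp
    finally show ?thesis using power2_le_imp_le[of "norm (B x)" "norm x"] by simp
  qed
  then have "norm B \<le> 1" by (intro norm_blinfun_bound) auto
  moreover have "selfadjoint_op B"
    unfolding B_def by (intro selfadjoint_op_diff selfadjoint_op_id selfadjoint_op_scaleR self)
  ultimately obtain P where P: "positive_op P" "op_square P = id_blinfun - B"
    "\<And>C. C o\<^sub>L B = B o\<^sub>L C \<Longrightarrow> C o\<^sub>L P = P o\<^sub>L C"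
    using positive_sqrt_exists_of_norm_le by blast
  have "positive_op (c *\<^sub>R P)"
    using P(1) \<open>c > 0\<close> by (simp add: positive_op_iff selfadjoint_op_scaleR blinfun.bilinear_simps)
  moreover have "op_square (c *\<^sub>R P) = A"
  proof (rule blinfun_eqI)
    fix x
    have "P (P x) = (1 / c\<^sup>2) *\<^sub>R A x"
      using arg_cong[OF P(2), of "\<lambda>T. blinfun_apply T x"]
      by (simp add: B_def blinfun.bilinear_simps)
    then show "op_square (c *\<^sub>R P) x = A x"
      using \<open>c > 0\<close> by (simp add: blinfun.bilinear_simps power2_eq_square)
  qed
  moreover have "C o\<^sub>L (c *\<^sub>R P) = (c *\<^sub>R P) o\<^sub>L C" if "C o\<^sub>L A = A o\<^sub>L C" for C
  proof -
    have "C (A x) = A (C x)" for x using that by (metis blinfun_apply_blinfun_compose)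
    then have "C o\<^sub>L B = B o\<^sub>L C"
      by (intro blinfun_eqI) (simp add: B_def blinfun.bilinear_simps)
    then have "C o\<^sub>L P = P o\<^sub>L C" by (rule P(3))
    then have "C (P x) = P (C x)" for x by (metis blinfun_apply_blinfun_compose)
    then show ?thesis by (intro blinfun_eqI) (simp add: blinfun.bilinear_simps)
  qed
  ultimately show ?thesis unfolding A_def by blast
qed

text \<open>
  For \<open>y = (P - Q) x\<close> commutation gives \<open>(P + Q) y = (P\<^sup>2 - Q\<^sup>2) x = 0\<close>. Both forms being
  nonnegative, \<open>P y = Q y = 0\<close>, whence \<open>\<langle>y, y\<rangle> = \<langle>x, (P - Q) y\<rangle> = 0\<close>.
\<close>

lemma commuting_positive_sqrt_unique:
  assumes P: "positive_op P" and Q: "positive_op Q"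
    and sq: "op_square P = op_square Q" and comm: "Q o\<^sub>L P = P o\<^sub>L Q"
  shows "Q = P"
proof (rule blinfun_eqI)
  fix x
  define y where "y = P x - Q x"
  have comm': "Q (P u) = P (Q u)" and sq': "P (P u) = Q (Q u)" for u
    using comm sq by (metis blinfun_apply_blinfun_compose)+
  have "P y + Q y = 0"
    using comm' sq' by (simp add: y_def blinfun.bilinear_simps)
  then have "inner (P y) y + inner (Q y) y = 0" by (metis inner_add_left inner_zero_left)
  moreover have "0 \<le> inner (P y) y" "0 \<le> inner (Q y) y"
    using P Q by (auto simp: positive_op_iff)
  ultimately have "inner (P y) y = 0" "inner (Q y) y = 0" by linarith+
  then have "P y = 0" "Q y = 0"
    using positive_op_inner_zero P Q by blast+
  moreover have "inner y y = inner x (P y) - inner x (Q y)"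
    using P Q by (metis (no_types, lifting) inner_diff_left positive_op_iff selfadjoint_op_iff y_def)
  ultimately show "Q x = P x" by (simp add: y_def)
qed

lemma op_square_op_abs:
  assumes T: "clinear_op T"
  shows "op_square (op_abs T) = adj T o\<^sub>L T"
proof -
  obtain P where P: "positive_op P" "op_square P = adj T o\<^sub>L T"
    "\<And>C. C o\<^sub>L (adj T o\<^sub>L T) = (adj T o\<^sub>L T) o\<^sub>L C \<Longrightarrow> C o\<^sub>L P = P o\<^sub>L C"
    using positive_sqrt_exists[OF T] by blast
  have unique: "Q = P" if "positive_op Q \<and> op_square Q = adj T o\<^sub>L T" for Q
  proof (rule commuting_positive_sqrt_unique)
    \<comment> \<open>A root of \<open>T\<^sup>*T\<close> commutes with its own square \<open>T\<^sup>*T\<close>, hence with \<open>P\<close>.\<close>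
    have "Q o\<^sub>L (Q o\<^sub>L Q) = (Q o\<^sub>L Q) o\<^sub>L Q" by (intro blinfun_eqI) simp
    then show "Q o\<^sub>L P = P o\<^sub>L Q" using that by (intro P(3)) simp
  qed (use P(1,2) that in auto)
  have "op_abs T = P"
    unfolding op_abs_def op_sqrt_def
  proof (rule the_equality)
    show "positive_op P \<and> op_square P = adj T o\<^sub>L T" using P(1,2) by blast
  qed (rule unique)
  then show ?thesis using P(2) by simp
qed

section \<open>A Chebyshev-type inequality for weighted sums of vectors\<close>

text \<open>
  The variance identity, used both for the vectors and for the complex weights.
\<close>

lemma sum_norm_diff_mean:
  fixes a :: "'i \<Rightarrow> 'a::real_inner"
  assumes "finite I" "I \<noteq> {}"
  shows "(\<Sum>k\<in>I. (norm (a k - (1 / real (card I)) *\<^sub>R (\<Sum>j\<in>I. a j)))\<^sup>2)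
    = (\<Sum>k\<in>I. (norm (a k))\<^sup>2) - (norm (\<Sum>k\<in>I. a k))\<^sup>2 / real (card I)"
proof -
  define S where "S = (\<Sum>j\<in>I. a j)"
  define r where "r = 1 / real (card I)"
  have "card I > 0" using assms by (simp add: card_gt_0_iff)
  then have r: "real (card I) * r = 1" by (simp add: r_def)
  have "(\<Sum>k\<in>I. (norm (a k - r *\<^sub>R S))\<^sup>2)
      = (\<Sum>k\<in>I. (norm (a k))\<^sup>2 - 2 * r * inner (a k) S + r\<^sup>2 * (norm S)\<^sup>2)"
    by (intro sum.cong refl)
      (simp add: power2_norm_eq_inner inner_diff inner_commute power2_eq_square[of r]
        algebra_simps)
  also have "\<dots> = (\<Sum>k\<in>I. (norm (a k))\<^sup>2) - 2 * r * (\<Sum>k\<in>I. inner (a k) S)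
      + real (card I) * (r\<^sup>2 * (norm S)\<^sup>2)"
    by (simp add: sum.distrib sum_subtractf sum_distrib_left)
  also have "(\<Sum>k\<in>I. inner (a k) S) = (norm S)\<^sup>2"
    by (simp add: S_def power2_norm_eq_inner inner_sum_left)
  also have "real (card I) * (r\<^sup>2 * (norm S)\<^sup>2) = (real (card I) * r) * r * (norm S)\<^sup>2"
    by (simp add: power2_eq_square)
  finally show ?thesis by (simp add: r S_def[symmetric] r_def[symmetric]) (simp add: r_def)
qed

text \<open>
  The expression on the left does not change if the weights and the vectors are replaced by their
  deviations from the mean, because the deviations of the vectors sum to zero; then the
  Cauchy-Schwarz inequality applies.
\<close>

lemma norm_weighted_sum_diff_means_le:
  fixes z :: "'i \<Rightarrow> complex" and a :: "'i \<Rightarrow> 'a::complex_inner"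
  assumes "finite I" "I \<noteq> {}"
  defines "n \<equiv> real (card I)"
  shows "(norm ((\<Sum>k\<in>I. z k *\<^sub>C a k) - (\<Sum>k\<in>I. z k) *\<^sub>C ((1 / n) *\<^sub>R (\<Sum>k\<in>I. a k))))\<^sup>2
    \<le> ((\<Sum>k\<in>I. (cmod (z k))\<^sup>2) - (cmod (\<Sum>k\<in>I. z k))\<^sup>2 / n)
      * ((\<Sum>k\<in>I. (norm (a k))\<^sup>2) - (norm (\<Sum>k\<in>I. a k))\<^sup>2 / n)"
proof -
  have "n > 0" using assms by (simp add: n_def card_gt_0_iff)
  define \<zeta> where "\<zeta> = (1 / n) *\<^sub>R (\<Sum>k\<in>I. z k)"
  define \<alpha> where "\<alpha> = (1 / n) *\<^sub>R (\<Sum>k\<in>I. a k)"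
  have "(\<Sum>k\<in>I. a k - \<alpha>) = (\<Sum>k\<in>I. a k) - n *\<^sub>R \<alpha>"
    by (simp add: sum_subtractf n_def sum_constant_scaleR)
  also have "\<dots> = 0" using \<open>n > 0\<close> by (simp add: \<alpha>_def)
  finally have centred: "(\<Sum>k\<in>I. a k - \<alpha>) = 0" .
  have "(\<Sum>k\<in>I. (z k - \<zeta>) *\<^sub>C (a k - \<alpha>)) = (\<Sum>k\<in>I. z k *\<^sub>C (a k - \<alpha>)) - \<zeta> *\<^sub>C (\<Sum>k\<in>I. a k - \<alpha>)"
    by (simp only: scaleC_diff_left scaleC_sum_right sum_subtractf[of "\<lambda>k. z k *\<^sub>C (a k - \<alpha>)"])
  also have "\<dots> = (\<Sum>k\<in>I. z k *\<^sub>C a k) - (\<Sum>k\<in>I. z k) *\<^sub>C \<alpha>"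
    unfolding centred by (simp add: scaleC_diff_right sum_subtractf scaleC_sum_left)
  finally have eq: "(\<Sum>k\<in>I. z k *\<^sub>C a k) - (\<Sum>k\<in>I. z k) *\<^sub>C \<alpha>
      = (\<Sum>k\<in>I. (z k - \<zeta>) *\<^sub>C (a k - \<alpha>))" ..
  have "norm (\<Sum>k\<in>I. (z k - \<zeta>) *\<^sub>C (a k - \<alpha>)) \<le> (\<Sum>k\<in>I. cmod (z k - \<zeta>) * norm (a k - \<alpha>))"
    using norm_sum[of "\<lambda>k. (z k - \<zeta>) *\<^sub>C (a k - \<alpha>)" I] by (simp add: norm_scaleC)
  then have "(norm (\<Sum>k\<in>I. (z k - \<zeta>) *\<^sub>C (a k - \<alpha>)))\<^sup>2
      \<le> (\<Sum>k\<in>I. cmod (z k - \<zeta>) * norm (a k - \<alpha>))\<^sup>2"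
    by (rule power_mono) simp
  also have "\<dots> \<le> (\<Sum>k\<in>I. (cmod (z k - \<zeta>))\<^sup>2) * (\<Sum>k\<in>I. (norm (a k - \<alpha>))\<^sup>2)"
    by (rule Cauchy_Schwarz_ineq_sum)
  finally show ?thesis
    unfolding eq[unfolded \<alpha>_def]
    unfolding \<alpha>_def \<zeta>_def n_def sum_norm_diff_mean[OF assms(1,2)] .
qed

section \<open>The discrete Fourier transform of operators\<close>

text \<open>
  With \<open>w = exp (i\<theta>)\<close> this is the telescoping sum
  \<open>(w - w\<^sup>-\<^sup>1) w\<^sup>2\<^sup>k = w\<^sup>2\<^sup>k\<^sup>+\<^sup>1 - w\<^sup>2\<^sup>k\<^sup>-\<^sup>1\<close>. Stated without division it also covers \<open>sin \<theta> = 0\<close>.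
\<close>

lemma sin_mult_sum_exp:
  fixes \<theta> :: real
  shows "complex_of_real (sin \<theta>) * (\<Sum>k=1..n. exp (2 * \<theta> * \<i> * of_nat k))
    = complex_of_real (sin (\<theta> * real n)) * exp (\<theta> * (of_nat n + 1) * \<i>)"
proof -
  define w where "w = exp (\<i> * \<theta>)"
  have w0: "w \<noteq> 0" by (simp add: w_def)
  have sin_eq: "complex_of_real (sin (\<theta> * real k)) = (w ^ k - inverse w ^ k) / (2 * \<i>)" for k
  proof -
    have "complex_of_real (sin (\<theta> * real k)) = sin (complex_of_real \<theta> * of_nat k)"
      by (simp add: sin_of_real[symmetric])
    also have "\<dots> = (w ^ k - inverse w ^ k) / (2 * \<i>)"
      by (simp add: sin_exp_eq w_def exp_of_nat_mult[symmetric] exp_minus[symmetric] mult_ac)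
    finally show ?thesis .
  qed
  have expw: "exp (2 * \<theta> * \<i> * of_nat k) = (w\<^sup>2) ^ k" for k
    by (simp add: w_def exp_of_nat_mult[symmetric] exp_double[symmetric] mult_ac power_mult[symmetric])
  have expn: "exp (\<theta> * (of_nat n + 1) * \<i>) = w ^ Suc n"
    unfolding w_def exp_of_nat_mult[symmetric] by (simp add: algebra_simps)
  have "(w - inverse w) * (\<Sum>k=1..n. (w\<^sup>2) ^ k) = (w ^ n - inverse w ^ n) * w ^ Suc n"
  proof (induction n)
    case (Suc n)
    have "(w - inverse w) * (\<Sum>k=1..Suc n. (w\<^sup>2) ^ k)
        = (w ^ n - inverse w ^ n) * w ^ Suc n + (w - inverse w) * (w\<^sup>2) ^ Suc n"
      using Suc by (simp add: ring_distribs)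
    also have "\<dots> = (w ^ Suc n - inverse w ^ Suc n) * w ^ Suc (Suc n)"
      using w0 by (simp add: field_simps power2_eq_square power_mult_distrib power_inverse)
    finally show ?case .
  qed simp
  then show ?thesis
    using sin_eq[of 1] unfolding sin_eq[of n] expw expn by simp
qed

theorem mainTheorem5:
  fixes A :: "nat \<Rightarrow> 'a::chilbert_space \<Rightarrow>\<^sub>L 'a"
    and \<omega> :: real and m n :: nat
  assumes "\<And>k. k \<in> {1..n} \<Longrightarrow> clinear_op (A k)"
    and "m \<in> {1..n}"
    and "sin (\<omega> * real m) \<noteq> 0"
  shows "op_square (op_abs
           ((\<Sum>k=1..n. exp (2 * complex_of_real \<omega> * \<i> * of_nat m * of_nat k) *\<^sub>C A k)
            - (complex_of_real (sin (\<omega> * real m * real n) / sin (\<omega> * real m))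
                 * exp (complex_of_real \<omega> * (of_nat n + 1) * \<i> * of_nat m))
              *\<^sub>C ((1 / real n) *\<^sub>R (\<Sum>k=1..n. A k))))
         \<preceq> ((real n)\<^sup>2 - (sin (\<omega> * real m * real n))\<^sup>2 / (sin (\<omega> * real m))\<^sup>2)
            *\<^sub>R ((1 / real n) *\<^sub>R (\<Sum>k=1..n. op_square (op_abs (A k)))
                - (1 / (real n)\<^sup>2) *\<^sub>R op_square (op_abs (\<Sum>k=1..n. A k)))"
proof -
  define z where "z k = exp (2 * complex_of_real \<omega> * \<i> * of_nat m * of_nat k)" for k :: nat
  define \<sigma> where "\<sigma> = sin (\<omega> * real m * real n) / sin (\<omega> * real m)"
  define e where "e = exp (complex_of_real \<omega> * (of_nat n + 1) * \<i> * of_nat m)"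
  define S where "S = (\<Sum>k=1..n. A k)"
  define X where "X = (\<Sum>k=1..n. z k *\<^sub>C A k) - (complex_of_real \<sigma> * e) *\<^sub>C ((1 / real n) *\<^sub>R S)"
  define R where "R = ((real n)\<^sup>2 - \<sigma>\<^sup>2) *\<^sub>R ((1 / real n) *\<^sub>R (\<Sum>k=1..n. adj (A k) o\<^sub>L A k)
    - (1 / (real n)\<^sup>2) *\<^sub>R (adj S o\<^sub>L S))"
  have n: "n > 0" and I: "finite {1..n}" "{1..n} \<noteq> {}" using assms(2) by auto
  have S: "clinear_op S" unfolding S_def using assms(1) by (rule clinear_op_sum)
  have X: "clinear_op X"
    unfolding X_def
    by (intro clinear_op_diff clinear_op_sum clinear_op_scaleC clinear_op_scaleR S assms(1))
  have sum_z: "(\<Sum>k=1..n. z k) = complex_of_real \<sigma> * e"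
  proof -
    have "complex_of_real (sin (\<omega> * real m)) * (\<Sum>k=1..n. z k)
        = complex_of_real (sin (\<omega> * real m * real n)) * e"
      using sin_mult_sum_exp[of "\<omega> * real m" n] by (simp add: z_def e_def mult_ac)
    then show ?thesis using assms(3) by (simp add: \<sigma>_def field_simps)
  qed
  have norm_z: "cmod (z k) = 1" for k by (simp add: z_def)
  have norm_e: "cmod e = 1" by (simp add: e_def)
  have self: "selfadjoint_op R"
    unfolding R_def
    by (intro selfadjoint_op_scaleR selfadjoint_op_diff selfadjoint_op_sum
        selfadjoint_op_adj_compose S assms(1))
  have "0 \<le> inner ((R - (adj X o\<^sub>L X)) x) x" for x
  proof -
    have "(norm (X x))\<^sup>2 \<le> (real n - \<sigma>\<^sup>2 / real n)
        * ((\<Sum>k=1..n. (norm (A k x))\<^sup>2) - (norm (S x))\<^sup>2 / real n)"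
      using norm_weighted_sum_diff_means_le[OF I, of z "\<lambda>k. A k x"]
      unfolding sum_z by (simp add: norm_z norm_e norm_mult X_def S_def blinfun.bilinear_simps)
    also have "\<dots> = ((real n)\<^sup>2 - \<sigma>\<^sup>2)
        * ((1 / real n) * (\<Sum>k=1..n. (norm (A k x))\<^sup>2) - (1 / (real n)\<^sup>2) * (norm (S x))\<^sup>2)"
      using n by (simp add: field_simps power2_eq_square)
    also have "\<dots> = inner (R x) x"
      using inner_adj_compose[OF assms(1)] inner_adj_compose[OF S]
      by (simp add: R_def blinfun.bilinear_simps blinfun.sum_left inner_diff_left inner_sum_left)
    finally show ?thesis
      using inner_adj_compose[OF X, of x] by (simp add: blinfun.bilinear_simps inner_diff_left)
  qed
  then have "adj X o\<^sub>L X \<preceq> R"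
    unfolding op_le_def positive_op_iff
    using self selfadjoint_op_adj_compose[OF X] selfadjoint_op_diff by blast
  then have "op_square (op_abs X) \<preceq> ((real n)\<^sup>2 - \<sigma>\<^sup>2) *\<^sub>R
      ((1 / real n) *\<^sub>R (\<Sum>k=1..n. op_square (op_abs (A k)))
       - (1 / (real n)\<^sup>2) *\<^sub>R op_square (op_abs S))"
    using assms(1) by (simp add: R_def op_square_op_abs X S)
  then show ?thesis
    unfolding X_def S_def z_def e_def \<sigma>_def power_divide .
qed

end
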